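(* Let $m > k \geq 3$ be integers, let $F$ be a $k$-graph on $m$ vertices, and let $F'\subseteq F$ be a subhypergraph of $F$. Suppose that one of the following conditions holds: (1) $\mathrm{ex}(m,F') + \prod_{i=0}^{k-1} \left\lfloor \frac{m+i}{k} \right\rfloor < e(F)$; or (2) for every partition $V(F) = V_1 \cup \dots \cup V_k$ of $V(F)$ into $k$ pairwise disjoint sets such that every edge of $F$ intersects $V_1$, there is some $2 \leq j \leq k$ such that $F-V_j$ contains a copy of $F'$. Then $\pi(F')<\pi(F)$.
   Context: A $k$-uniform hypergraph ($k$-graph) $H=(V,E)$ has vertex set $V$ and edge set $E\subseteq \binom{V}{k}$; $e(H)=|E|$. For $S\subseteq V$, $H-S$ denotes the $k$-graph with vertex set $V\setminus S$ and edge set $\{e\in E: e\subseteq V\setminus S\}$. For $k$-graphs $F,H$, $H$ is $F$-free if $H$ contains no copy of $F$. The Turán number $\mathrm{ex}(n,F)$ is the maximum number of edges of an $F$-free $k$-graph on $n$ vertices, and the Turán density is $\pi(F)=\lim_{n\to\infty}\mathrm{ex}(n,F)/\binom{n}{k}$. *)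

theory Defs
  imports Complex_Main "HOL-Library.Ramsey" "HOL-Library.Disjoint_Sets"
begin

datatype 'a hypergraph = Hypergraph (verts: "'a set") (edges: "'a set set")

definition kgraph :: "nat \<Rightarrow> 'a hypergraph \<Rightarrow> bool" where
  "kgraph k H \<longleftrightarrow> finite (verts H) \<and> edges H \<subseteq> nsets (verts H) k"

definition subhypergraph :: "'a hypergraph \<Rightarrow> 'a hypergraph \<Rightarrow> bool" where
  "subhypergraph F' F \<longleftrightarrow> verts F' \<subseteq> verts F \<and> edges F' \<subseteq> edges F"

definition delete_verts :: "'a hypergraph \<Rightarrow> 'a set \<Rightarrow> 'a hypergraph" where
  "delete_verts H S = Hypergraph (verts H - S) {e \<in> edges H. e \<subseteq> verts H - S}"

(* Copies need not be induced.  Isolated vertices of F also have to be embedded. *)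
definition contains_copy :: "'a hypergraph \<Rightarrow> 'b hypergraph \<Rightarrow> bool" where
  "contains_copy H F \<longleftrightarrow>
     (\<exists>f. inj_on f (verts F) \<and> f ` verts F \<subseteq> verts H \<and> (\<forall>e\<in>edges F. f ` e \<in> edges H))"

(* Up to isomorphism every finite k-graph lives on a set of natural numbers, so it suffices
   to range over these.  The set below is bounded by n choose k; it is nonempty whenever F has
   an edge.  If F is edgeless and n is at least the number of vertices of F, there is no F-free
   k-graph on n vertices, the maximum does not exist and the value is unspecified. *)
definition turan_number :: "nat \<Rightarrow> nat \<Rightarrow> 'a hypergraph \<Rightarrow> nat" where
  "turan_number k n F =
     Max {card (edges H) | H :: nat hypergraph.
            kgraph k H \<and> card (verts H) = n \<and> \<not> contains_copy H F}"

definition turan_density :: "nat \<Rightarrow> 'a hypergraph \<Rightarrow> real" where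
  "turan_density k F = lim (\<lambda>n. real (turan_number k n F) / real (n choose k))"

end

theory Submission
  imports Defs "HOL-Library.FuncSet"
begin

text \<open>
  Let \<open>H\<close> be an extremal \<open>F'\<close>-free \<open>k\<close>-graph and split its vertex set into parts
  \<open>U 1, \<dots>, U k\<close>. Delete the edges of \<open>H\<close> that miss \<open>U 1\<close> and add all edges with one
  vertex in every part. The result is \<open>F\<close>-free: under (1) because \<open>m\<close> vertices span too few
  edges, and under (2) because a copy of \<open>F\<close> would be partitioned so that all its edges meet the
  first part, while deleting any other part leaves only edges of \<open>H\<close>. If all parts but \<open>U 1\<close>
  have about \<open>\<delta> n\<close> vertices, one loses \<open>O(\<delta>\<^sup>k)\<close> of the edge density but gains order
  \<open>\<delta>\<^sup>k\<^sup>-\<^sup>1\<close> on average over the choice of the parts, since \<open>H\<close> misses a positive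
  proportion of all \<open>k\<close>-sets.
\<close>

section \<open>Turan numbers\<close>

lemma finite_edges: "kgraph k H \<Longrightarrow> finite (edges H)"
  unfolding kgraph_def by (auto intro: finite_subset finite_imp_finite_nsets)

lemma card_edges_le: "kgraph k H \<Longrightarrow> card (edges H) \<le> card (verts H) choose k"
  using card_mono[of "nsets (verts H) k" "edges H"]
  by (simp add: kgraph_def card_nsets finite_imp_finite_nsets)

lemma contains_copy_mono:
  assumes "verts G \<subseteq> verts H" "edges G \<subseteq> edges H" "contains_copy G F"
  shows "contains_copy H F"
  using assms unfolding contains_copy_def by (elim exE, intro exI) auto

lemma finite_free_sizes:
  "finite {card (edges H) | H :: nat hypergraph.
      kgraph k H \<and> card (verts H) = n \<and> \<not> contains_copy H F}"
  by (rule finite_subset[of _ "{..n choose k}"]) (auto dest: card_edges_le)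

lemma card_edges_le_turan_number:
  fixes H :: "nat hypergraph"
  assumes "kgraph k H" "\<not> contains_copy H F"
  shows "card (edges H) \<le> turan_number k (card (verts H)) F"
  unfolding turan_number_def using assms by (intro Max_ge[OF finite_free_sizes]) blast

text \<open>Since \<open>F\<close> has an edge, the edgeless graph on \<open>n\<close> vertices is
  \<open>F\<close>-free, so the maximum ranges over a nonempty finite set.\<close>

lemma turan_number_attained:
  assumes "edges F \<noteq> {}"
  obtains H :: "nat hypergraph"
  where "kgraph k H" "card (verts H) = n" "\<not> contains_copy H F"
    "card (edges H) = turan_number k n F"
proof -
  let ?S = "{card (edges H) | H :: nat hypergraph.
      kgraph k H \<and> card (verts H) = n \<and> \<not> contains_copy H F}"
  have "kgraph k (Hypergraph {..<n} {})" "card (verts (Hypergraph {..<n} {})) = n"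
    "\<not> contains_copy (Hypergraph {..<n} {}) F"
    using assms by (auto simp: kgraph_def contains_copy_def)
  then have "?S \<noteq> {}" by blast
  then have "turan_number k n F \<in> ?S"
    unfolding turan_number_def by (rule Max_in[OF finite_free_sizes])
  then show ?thesis using that by auto
qed

section \<open>Monotonicity and convergence of the normalised Turan numbers\<close>

lemma kgraph_delete_verts: "kgraph k H \<Longrightarrow> kgraph k (delete_verts H S)"
  by (auto simp: kgraph_def delete_verts_def nsets_def)

lemma delete_verts_free:
  "\<not> contains_copy H F \<Longrightarrow> \<not> contains_copy (delete_verts H S) F"
  using contains_copy_mono[of "delete_verts H S" H F] by (auto simp: delete_verts_def)

text \<open>Averaging over vertex deletions: remove each vertex of an extremal graph in turn. Every
  edge survives exactly \<open>Suc n - k\<close> of the deletions, and each remaining graph is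
  \<open>F\<close>-free on \<open>n\<close> vertices.\<close>

lemma turan_number_Suc:
  assumes "edges F \<noteq> {}"
  shows "(Suc n - k) * turan_number k (Suc n) F \<le> Suc n * turan_number k n F"
proof -
  obtain H :: "nat hypergraph" where H: "kgraph k H" "card (verts H) = Suc n"
    "\<not> contains_copy H F" "card (edges H) = turan_number k (Suc n) F"
    using turan_number_attained[OF assms] by blast
  have fin: "finite (verts H)" using H(1) by (simp add: kgraph_def)
  have e: "e \<subseteq> verts H \<and> finite e \<and> card e = k" if "e \<in> edges H" for e
    using that H(1) by (auto simp: kgraph_def nsets_def)
  have "card {v \<in> verts H. v \<notin> e} = Suc n - k" if "e \<in> edges H" for e
  proof -
    have "{v \<in> verts H. v \<notin> e} = verts H - e" by auto
    then show ?thesis using e[OF that] H(2) by (simp add: card_Diff_subset)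
  qed
  then have "(\<Sum>v\<in>verts H. card {e \<in> edges H. v \<notin> e}) = (\<Sum>e\<in>edges H. Suc n - k)"
    by (intro sum_multicount_gen fin finite_edges[OF H(1)]) blast
  also have "\<dots> = (Suc n - k) * turan_number k (Suc n) F"
    by (simp add: H(4))
  finally have "(Suc n - k) * turan_number k (Suc n) F =
    (\<Sum>v\<in>verts H. card {e \<in> edges H. v \<notin> e})" by simp
  also have "\<dots> \<le> (\<Sum>v\<in>verts H. turan_number k n F)"
  proof (rule sum_mono)
    fix v assume v: "v \<in> verts H"
    have "edges (delete_verts H {v}) = {e \<in> edges H. v \<notin> e}"
      using e by (auto simp: delete_verts_def)
    moreover have "card (verts (delete_verts H {v})) = n"
      using v H(2) fin by (simp add: delete_verts_def)
    ultimately show "card {e \<in> edges H. v \<notin> e} \<le> turan_number k n F"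
      using card_edges_le_turan_number[OF kgraph_delete_verts[OF H(1)] delete_verts_free[OF H(3)], of "{v}"]
      by simp
  qed
  also have "\<dots> = Suc n * turan_number k n F" by (simp add: H(2))
  finally show ?thesis .
qed

text \<open>The factors in \<open>turan_number_Suc\<close> are those of the recursion for
  \<open>Suc i choose k\<close>, so they cancel in the quotient.\<close>

lemma turan_ratio_antimono:
  assumes "edges F \<noteq> {}" "k \<le> n" "n \<le> n'"
  shows "real (turan_number k n' F) / real (n' choose k)
    \<le> real (turan_number k n F) / real (n choose k)"
  using assms(3)
proof (induction n' rule: dec_induct)
  case (step i)
  have "k \<le> i" using step assms by simp
  have "(Suc i - k) * (Suc i choose k) = Suc i * (i choose k)"
    using binomial_absorb_comp[of "Suc i" k] by simp
  then have b: "real (Suc i - k) * real (Suc i choose k) = real (Suc i) * real (i choose k)"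
    by (metis of_nat_mult)
  have t: "real (Suc i - k) * real (turan_number k (Suc i) F)
      \<le> real (Suc i) * real (turan_number k i F)"
    using turan_number_Suc[OF assms(1), of i k] by (metis of_nat_le_iff of_nat_mult)
  have pos: "real (Suc i - k) > 0" "real (Suc i choose k) > 0" "real (i choose k) > 0"
    using \<open>k \<le> i\<close> by auto
  have "real (turan_number k (Suc i) F) / real (Suc i choose k) =
    (real (Suc i - k) * real (turan_number k (Suc i) F)) / (real (Suc i) * real (i choose k))"
    using pos b by (metis mult_divide_mult_cancel_left less_irrefl)
  also have "\<dots> \<le> (real (Suc i) * real (turan_number k i F)) / (real (Suc i) * real (i choose k))"
    by (rule divide_right_mono[OF t]) simp
  also have "\<dots> = real (turan_number k i F) / real (i choose k)"
    by simp
  finally show ?case using step by linarith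
qed simp

text \<open>\<open>lim\<close> carries information only for convergent sequences; convergence holds
  because the ratios decrease and are nonnegative.\<close>

lemma turan_density_LIMSEQ:
  assumes "edges F \<noteq> {}"
  shows "(\<lambda>n. real (turan_number k n F) / real (n choose k)) \<longlonglongrightarrow> turan_density k F"
proof -
  let ?r = "\<lambda>n. real (turan_number k n F) / real (n choose k)"
  \<comment> \<open>The shift skips \<open>n < k\<close>, where the binomial coefficient is 0, the
    quotient is 0 by convention and monotonicity fails in general.\<close>
  have "convergent (\<lambda>n. ?r (n + k))"
  proof (rule decseq_convergent[of _ 0])
    show "decseq (\<lambda>n. ?r (n + k))"
      unfolding decseq_def using turan_ratio_antimono[OF assms] by simp
  qed (auto intro: convergentI)
  then have "convergent ?r"
    using convergent_ignore_initial_segment by blast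
  then show ?thesis
    unfolding turan_density_def by (simp add: convergent_LIMSEQ_iff)
qed

text \<open>The complete \<open>k\<close>-graph on \<open>m\<close> vertices contains \<open>F\<close>.\<close>
lemma turan_number_less_binomial:
  assumes "kgraph k F" "edges F \<noteq> {}" "card (verts F) \<le> m"
  shows "turan_number k m F < m choose k"
proof -
  obtain H :: "nat hypergraph" where H: "kgraph k H" "card (verts H) = m"
    "\<not> contains_copy H F" "card (edges H) = turan_number k m F"
    using turan_number_attained[OF assms(2)] by blast
  have finF: "finite (verts F)" and fin: "finite (verts H)"
    and sub: "edges H \<subseteq> nsets (verts H) k"
    using assms(1) H(1) by (auto simp: kgraph_def)
  have "edges H \<noteq> nsets (verts H) k"
  proof
    assume complete: "edges H = nsets (verts H) k"
    obtain f where f: "inj_on f (verts F)" "f ` verts F \<subseteq> verts H"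
      using card_le_inj[OF finF fin] assms(3) H(2) by auto
    have "f ` e \<in> nsets (verts H) k" if "e \<in> edges F" for e
    proof -
      have "e \<subseteq> verts F" "finite e" "card e = k"
        using that assms(1) by (auto simp: kgraph_def nsets_def)
      then show ?thesis
        using f by (auto simp: nsets_def card_image inj_on_subset)
    qed
    then have "contains_copy H F"
      unfolding contains_copy_def using f complete by auto
    with H(3) show False ..
  qed
  then have "card (edges H) < card (nsets (verts H) k)"
    using sub fin by (intro psubset_card_mono finite_imp_finite_nsets) auto
  then show ?thesis using H by (simp add: card_nsets)
qed

section \<open>Products of integers with a given sum\<close>

text \<open>The exponential \<open>a \<mapsto> q r\<^sup>a\<^sup>-\<^sup>q\<close> with \<open>r = (q + 1) / q\<close> agrees with \<open>a\<close> at \<open>q\<close> and \<open>q + 1\<close>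
  and is convex, so it dominates \<open>a\<close> at all integers.\<close>
lemma le_exponential_through_consecutive:
  fixes q a :: nat
  defines "r \<equiv> (real q + 1) / real q"
  assumes "q > 0"
  shows "real a * r ^ q \<le> real q * r ^ a"
proof (cases "q \<le> a")
  case True
  have "1 + real (a - q) * (1 / real q) \<le> (1 + 1 / real q) ^ (a - q)"
    by (rule Bernoulli_inequality) (simp add: order_trans[of _ 0])
  moreover have "1 + 1 / real q = r"
    using assms by (simp add: r_def field_simps)
  moreover have "1 + real (a - q) * (1 / real q) = real a / real q"
    using True assms by (simp add: field_simps of_nat_diff)
  ultimately have "real a \<le> real q * r ^ (a - q)"
    using assms by (simp add: field_simps)
  then have "real a * r ^ q \<le> real q * r ^ (a - q) * r ^ q"
    by (rule mult_right_mono) (simp add: r_def)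
  then show ?thesis using True by (simp add: mult.assoc flip: power_add)
next
  case False
  \<comment> \<open>Below \<open>q\<close>, Bernoulli is applied to the reciprocal base 1/r = 1 -
    1/(q + 1).\<close>
  let ?t = "q - a"
  have r: "r > 0" using assms by (simp add: r_def)
  have "1 + real ?t * (- 1 / (real q + 1)) \<le> (1 + - 1 / (real q + 1)) ^ ?t"
    by (rule Bernoulli_inequality) (simp add: field_simps)
  moreover have "1 + - 1 / (real q + 1) = 1 / r"
    using assms by (simp add: r_def field_simps)
  moreover have "real a / real q \<le> 1 + real ?t * (- 1 / (real q + 1))"
  proof -
    have "real ?t / (real q + 1) \<le> real ?t / real q"
      using assms by (intro divide_left_mono) auto
    also have "\<dots> = 1 - real a / real q"
      using False assms by (simp add: field_simps of_nat_diff)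
    finally show ?thesis by simp
  qed
  ultimately have "real a / real q \<le> 1 / r ^ ?t"
    by (simp add: power_one_over)
  then have "real a * r ^ ?t \<le> real q"
    using assms r by (simp add: field_simps)
  then have "real a * r ^ ?t * r ^ a \<le> real q * r ^ a"
    using r by (intro mult_right_mono) auto
  then show ?thesis using False by (simp add: mult.assoc flip: power_add)
qed

text \<open>Adding \<open>i < k\<close> to \<open>m\<close> reaches the next multiple of
  \<open>k\<close> exactly when \<open>i\<close> is at least \<open>k - m mod k\<close>.\<close>

lemma prod_balanced:
  fixes m k :: nat
  assumes "k > 0"
  shows "(\<Prod>i=0..k-1. (m + i) div k)
    = (m div k) ^ (k - m mod k) * Suc (m div k) ^ (m mod k)"
proof -
  let ?q = "m div k" and ?s = "m mod k"
  have s: "?s < k" using assms by simp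
  have I: "{0..k-1} = {..<k - ?s} \<union> {k - ?s..<k}" using s by auto
  have low: "(m + i) div k = ?q" if "i < k - ?s" for i
  proof (rule div_nat_eqI)
    have "m = k * ?q + ?s" by simp
    then show "k * ?q \<le> m + i" "m + i < k * Suc ?q" using that by (simp_all, linarith+)
  qed
  have high: "(m + i) div k = Suc ?q" if "k - ?s \<le> i" "i < k" for i
  proof (rule div_nat_eqI)
    have "m = k * ?q + ?s" by simp
    then show "k * Suc ?q \<le> m + i" "m + i < k * Suc (Suc ?q)"
      using that s by (simp_all, linarith+)
  qed
  have "(\<Prod>i=0..k-1. (m + i) div k)
    = (\<Prod>i<k - ?s. (m + i) div k) * (\<Prod>i=k - ?s..<k. (m + i) div k)"
    unfolding I by (rule prod.union_disjoint) auto
  also have "(\<Prod>i<k - ?s. (m + i) div k) = (\<Prod>i<k - ?s. ?q)"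
    by (rule prod.cong) (auto simp: low)
  also have "(\<Prod>i=k - ?s..<k. (m + i) div k) = (\<Prod>i=k - ?s..<k. Suc ?q)"
    by (rule prod.cong) (use high in auto)
  finally show ?thesis using s by simp
qed

text \<open>Multiplying the exponential bounds for all \<open>a i\<close> gives a right-hand side
  that depends only on the sum \<open>m\<close>. Balanced factors, all equal to \<open>q\<close> or
  \<open>q + 1\<close>, give equality in each bound, so that value is the balanced product.\<close>

lemma prod_le_balanced:
  fixes a :: "'i \<Rightarrow> nat"
  assumes "finite I" "card I = k" "k > 0" "(\<Sum>i\<in>I. a i) = m"
  shows "(\<Prod>i\<in>I. a i) \<le> (\<Prod>i=0..k-1. (m + i) div k)"
\<comment> \<open>The exponential needs \<open>q > 0\<close>. If \<open>m < k\<close>, some factor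
  vanishes.\<close>
proof (cases "m div k = 0")
  case True
  then have "m < k" using assms(3) by (simp add: div_eq_0_iff)
  have "\<exists>i\<in>I. a i = 0"
  proof (rule ccontr)
    assume "\<not> ?thesis"
    then have "(\<Sum>i\<in>I. 1) \<le> (\<Sum>i\<in>I. a i)" by (intro sum_mono) (simp add: Suc_leI)
    with assms \<open>m < k\<close> show False by simp
  qed
  then have "(\<Prod>i\<in>I. a i) = 0" using assms(1) by simp
  then show ?thesis by simp
next
  case False
  define q where "q = m div k"
  define r where "r = (real q + 1) / real q"
  have q: "q > 0" using False by (simp add: q_def)
  then have r: "r > 0" by (simp add: r_def)
  have m: "m = q * k + m mod k" by (simp add: q_def)
  have "(\<Prod>i\<in>I. real (a i) * r ^ q) \<le> (\<Prod>i\<in>I. real q * r ^ a i)"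
    using le_exponential_through_consecutive[OF q] r
    by (intro prod_mono) (auto simp: r_def)
  then have "(\<Prod>i\<in>I. real (a i)) * r ^ (q * k) \<le> real q ^ k * r ^ m"
    using assms by (simp add: prod.distrib power_mult power_sum[symmetric])
  also have "r ^ m = r ^ (m mod k) * r ^ (q * k)"
    by (subst m) (simp add: power_add)
  finally have "(\<Prod>i\<in>I. real (a i)) \<le> real q ^ k * r ^ (m mod k)"
    using r by (simp add: mult.assoc[symmetric])
  also have "\<dots> = real q ^ (k - m mod k) * (real q ^ (m mod k) * r ^ (m mod k))"
    using assms(3) by (simp add: mult.assoc[symmetric] power_add[symmetric] less_imp_le)
  also have "real q ^ (m mod k) * r ^ (m mod k) = (real q + 1) ^ (m mod k)"
    using q by (simp add: r_def flip: power_mult_distrib)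
  also have "real q ^ (k - m mod k) * (real q + 1) ^ (m mod k)
      = real (\<Prod>i=0..k-1. (m + i) div k)"
    unfolding prod_balanced[OF assms(3)] q_def by (simp add: add.commute)
  finally show ?thesis by (simp flip: of_nat_prod)
qed

section \<open>The modified hypergraph\<close>

text \<open>As \<open>e\<close> has only \<open>k\<close> elements, it meets each colour exactly
  once: these are the edges of the complete \<open>k\<close>-partite \<open>k\<close>-graph on the
  colour classes of \<open>p\<close> in \<open>W\<close>.\<close>

definition transversals :: "nat \<Rightarrow> 'a set \<Rightarrow> ('a \<Rightarrow> nat) \<Rightarrow> 'a set set" where
  "transversals k W p = {e \<in> nsets W k. \<forall>i\<in>{1..k}. \<exists>v\<in>e. p v = i}"

definition augment :: "nat \<Rightarrow> 'a hypergraph \<Rightarrow> ('a \<Rightarrow> nat) \<Rightarrow> 'a hypergraph" where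
  "augment k H p = Hypergraph (verts H)
     ({e \<in> edges H. \<exists>v\<in>e. p v = 1} \<union> transversals k (verts H) p)"

lemma kgraph_augment: "kgraph k H \<Longrightarrow> kgraph k (augment k H p)"
  by (auto simp: kgraph_def augment_def transversals_def)

text \<open>Choosing from \<open>e\<close> its vertex of each colour yields a choice function with
  image \<open>e\<close>, so there are at most as many transversals as choice functions.\<close>

lemma card_transversals_le:
  assumes "finite W"
  shows "card (transversals k W p) \<le> (\<Prod>i\<in>{1..k}. card {v \<in> W. p v = i})"
proof -
  let ?P = "PiE {1..k} (\<lambda>i. {v \<in> W. p v = i})"
  have "transversals k W p \<subseteq> (\<lambda>h. h ` {1..k}) ` ?P"
  proof
    fix e assume e: "e \<in> transversals k W p"
    then have eW: "e \<subseteq> W" "finite e" "card e = k"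
      and "\<forall>i\<in>{1..k}. \<exists>v. v \<in> e \<and> p v = i"
      by (auto simp: transversals_def nsets_def)
    then obtain h where h: "\<forall>i\<in>{1..k}. h i \<in> e \<and> p (h i) = i"
      by metis
    have "inj_on h {1..k}" by (rule inj_onI) (metis h)
    then have "h ` {1..k} = e"
      using h eW by (intro card_subset_eq) (auto simp: card_image)
    moreover have "restrict h {1..k} \<in> ?P" using h eW by auto
    ultimately show "e \<in> (\<lambda>h. h ` {1..k}) ` ?P"
      by (intro image_eqI[of _ _ "restrict h {1..k}"]) auto
  qed
  then have "card (transversals k W p) \<le> card ((\<lambda>h. h ` {1..k}) ` ?P)"
    using assms by (intro card_mono finite_imageI finite_PiE) auto
  also have "\<dots> \<le> card ?P"
    using assms by (intro card_image_le finite_PiE) auto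
  finally show ?thesis by (simp add: card_PiE)
qed

text \<open>Let \<open>W\<close> be the vertex set of a copy of \<open>F\<close>. The edges inside
  \<open>W\<close> come either from \<open>H\<close> induced on \<open>W\<close>, which is
  \<open>F'\<close>-free on \<open>m\<close> vertices, or from the transversals of \<open>W\<close>,
  whose number is at most the balanced product.\<close>

lemma augment_free_of_many_edges:
  fixes H :: "nat hypergraph"
  assumes "k > 0" "kgraph k F" "card (verts F) = m"
    and "turan_number k m F' + (\<Prod>i=0..k-1. (m + i) div k) < card (edges F)"
    and H: "kgraph k H" "\<not> contains_copy H F'"
    and p: "p ` verts H \<subseteq> {1..k}"
  shows "\<not> contains_copy (augment k H p) F"
proof
  assume "contains_copy (augment k H p) F"
  then obtain f where f: "inj_on f (verts F)" "f ` verts F \<subseteq> verts H"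
    "\<And>e. e \<in> edges F \<Longrightarrow> f ` e \<in> edges (augment k H p)"
    by (auto simp: contains_copy_def augment_def)
  define W where "W = f ` verts F"
  have W: "W \<subseteq> verts H" "card W = m" "finite W"
    using f assms(2,3) by (auto simp: W_def card_image kgraph_def)
  \<comment> \<open>Deleting the complement of \<open>W\<close> leaves the subgraph induced on
    \<open>W\<close>.\<close>
  let ?G = "delete_verts H (verts H - W)"
  have vG: "verts ?G = W" using W by (auto simp: delete_verts_def)
  have eG: "edges ?G = {e \<in> edges H. e \<subseteq> W}" using W by (auto simp: delete_verts_def)
  have eF: "e \<subseteq> verts F" if "e \<in> edges F" for e
    using that assms(2) by (auto simp: kgraph_def nsets_def)
  have "(`) f ` edges F \<subseteq> edges ?G \<union> transversals k W p"
  proof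
    fix e assume "e \<in> (`) f ` edges F"
    then have "e \<in> edges (augment k H p)" "e \<subseteq> W"
      using f(3) eF by (auto simp: W_def dest: image_mono)
    then show "e \<in> edges ?G \<union> transversals k W p"
      unfolding eG by (auto simp: augment_def transversals_def nsets_def)
  qed
  moreover have "finite (edges ?G \<union> transversals k W p)"
    using finite_edges[OF kgraph_delete_verts[OF H(1)]] finite_imp_finite_nsets[OF W(3)]
    by (auto simp: transversals_def)
  ultimately have "card ((`) f ` edges F) \<le> card (edges ?G \<union> transversals k W p)"
    by (intro card_mono)
  also have "\<dots> \<le> card (edges ?G) + card (transversals k W p)"
    by (rule card_Un_le)
  also have "card (edges ?G) \<le> turan_number k m F'"
    using card_edges_le_turan_number[OF kgraph_delete_verts[OF H(1)] delete_verts_free[OF H(2)]]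
      vG W(2) by metis
  also have "card (transversals k W p) \<le> (\<Prod>i\<in>{1..k}. card {v \<in> W. p v = i})"
    by (rule card_transversals_le[OF W(3)])
  also have "\<dots> \<le> (\<Prod>i=0..k-1. (m + i) div k)"
  proof (rule prod_le_balanced)
    have "W = (\<Union>i\<in>{1..k}. {v \<in> W. p v = i})" using p W by auto
    then have "card W = card (\<Union>i\<in>{1..k}. {v \<in> W. p v = i})" by simp
    also have "\<dots> = (\<Sum>i\<in>{1..k}. card {v \<in> W. p v = i})"
      using W(3) by (intro card_UN_disjoint) auto
    finally show "(\<Sum>i\<in>{1..k}. card {v \<in> W. p v = i}) = m" using W(2) by simp
  qed (use assms(1) in auto)
  finally have "card ((`) f ` edges F) \<le> turan_number k m F' + (\<Prod>i=0..k-1. (m + i) div k)"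
    by simp
  moreover have "inj_on ((`) f) (edges F)"
    by (rule inj_on_subset[OF inj_on_image_Pow[OF f(1)]]) (use eF in auto)
  ultimately show False using assms(4) by (simp add: card_image)
qed

text \<open>The colouring is pulled back along a copy of \<open>F\<close>. Every edge of
  \<open>augment k H p\<close> meets colour 1, so the partition hypothesis applies and yields a copy
  of \<open>F'\<close> avoiding some colour \<open>j\<close>; its edges cannot be transversals, so
  it lies in \<open>H\<close>.\<close>

lemma augment_free_of_partition:
  assumes "kgraph k F"
    and part: "\<And>V :: nat \<Rightarrow> 'a set.
            disjoint_family_on V {1..k} \<Longrightarrow> (\<Union>i\<in>{1..k}. V i) = verts F
              \<Longrightarrow> (\<forall>e\<in>edges F. e \<inter> V 1 \<noteq> {})
            \<Longrightarrow> (\<exists>j\<in>{2..k}. contains_copy (delete_verts F (V j)) F')"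
    and "k > 0" "\<not> contains_copy H F'"
    and p: "p ` verts H \<subseteq> {1..k}"
  shows "\<not> contains_copy (augment k H p) F"
proof
  assume "contains_copy (augment k H p) F"
  then obtain f where f: "inj_on f (verts F)" "f ` verts F \<subseteq> verts H"
    "\<And>e. e \<in> edges F \<Longrightarrow> f ` e \<in> edges (augment k H p)"
    by (auto simp: contains_copy_def augment_def)
  define V where "V i = {v \<in> verts F. p (f v) = i}" for i
  have eF: "e \<subseteq> verts F" if "e \<in> edges F" for e
    using that assms(1) by (auto simp: kgraph_def nsets_def)
  have "\<exists>j\<in>{2..k}. contains_copy (delete_verts F (V j)) F'"
  proof (rule part)
    show "disjoint_family_on V {1..k}" by (auto simp: disjoint_family_on_def V_def)
    show "(\<Union>i\<in>{1..k}. V i) = verts F" using f(2) p by (fastforce simp: V_def)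
    show "\<forall>e\<in>edges F. e \<inter> V 1 \<noteq> {}"
    proof
      fix e assume e: "e \<in> edges F"
      have "1 \<in> {1..k}" using \<open>k > 0\<close> by simp
      then have "\<exists>w\<in>f ` e. p w = 1"
        using f(3)[OF e] by (auto simp: augment_def transversals_def)
      then show "e \<inter> V 1 \<noteq> {}" using eF[OF e] by (auto simp: V_def)
    qed
  qed
  then obtain j g where j: "j \<in> {2..k}" and g: "inj_on g (verts F')"
    "g ` verts F' \<subseteq> verts F - V j"
    "\<And>e. e \<in> edges F' \<Longrightarrow> g ` e \<in> edges F \<and> g ` e \<subseteq> verts F - V j"
    by (auto simp: contains_copy_def delete_verts_def)
  have "(f \<circ> g) ` e \<in> edges H" if "e \<in> edges F'" for e
  proof -
    have "f ` g ` e \<in> edges (augment k H p)" using f(3) g(3) that by blast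
    moreover have "p w \<noteq> j" if "w \<in> f ` g ` e" for w
      using that g(3)[OF \<open>e \<in> edges F'\<close>] by (auto simp: V_def)
    then have "f ` g ` e \<notin> transversals k (verts H) p"
      using j unfolding transversals_def by fastforce
    ultimately show ?thesis by (auto simp: augment_def image_comp)
  qed
  moreover have "inj_on (f \<circ> g) (verts F')"
    using g f(1) by (intro comp_inj_on) (auto intro: inj_on_subset)
  moreover have "(f \<circ> g) ` verts F' \<subseteq> verts H" using f(2) g(2) by auto
  ultimately have "contains_copy H F'" unfolding contains_copy_def by blast
  with assms(4) show False ..
qed

section \<open>Averaging over partitions\<close>

text \<open>Counts colourings restricted on one \<open>k\<close>-set only; it serves both the edges
  that may be lost and the edges that may be gained.\<close>

lemma card_PiE_constrained:
  assumes "finite V" "e \<subseteq> V"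
  shows "card (PiE V (\<lambda>v. if v \<in> e then B v else A))
    = (\<Prod>v\<in>e. card (B v)) * card A ^ (card V - card e)"
proof -
  have "card (PiE V (\<lambda>v. if v \<in> e then B v else A))
      = (\<Prod>v\<in>V. if v \<in> e then card (B v) else card A)"
    by (simp add: card_PiE assms(1) if_distrib)
  also have "\<dots> = (\<Prod>v\<in>e. card (B v)) * (\<Prod>v\<in>V - e. card A)"
    using assms by (simp add: prod.If_cases Int_absorb1 Diff_eq)
  also have "(\<Prod>v\<in>V - e. card A) = card A ^ (card V - card e)"
    using assms by (simp add: card_Diff_subset finite_subset)
  finally show ?thesis .
qed

text \<open>The parts come from uniformly random colourings with \<open>N\<close> colours: each of the colours
  \<open>2, \<dots>, k\<close> is a part of its own, and the remaining colours together form part \<open>1\<close>.\<close>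
lemma augment_average:
  assumes "kgraph k H" "k > 0" "k \<le> N"
    and T: "\<And>p. p ` verts H \<subseteq> {1..k} \<Longrightarrow> card (edges (augment k H p)) \<le> T"
  shows "N ^ k * card (edges H) + ((card (verts H) choose k) - card (edges H)) * (N - k + 1)
    \<le> N ^ k * T + card (edges H) * (k - 1) ^ k"
\<comment> \<open>With fewer than \<open>k\<close> vertices the left-hand side is 0; otherwise
  \<open>n - k\<close> below is a genuine difference.\<close>
proof (cases "k \<le> card (verts H)")
  case False
  then have "edges H = {}"
    using card_edges_le[OF assms(1)] finite_edges[OF assms(1)] by (simp add: binomial_eq_0)
  then show ?thesis using False by (simp add: binomial_eq_0)
next
  case True
  define V where "V = verts H"
  define n where "n = card V"
  define P where "P = PiE V (\<lambda>_. {1..N})"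
  define part :: "nat \<Rightarrow> nat" where "part x = (if x \<in> {2..k} then x else 1)" for x
  define K where "K = nsets V k - edges H"
  \<comment> \<open>\<open>L c\<close> collects the edges of \<open>H\<close> that are deleted,
    \<open>G c\<close> the non-edges of \<open>H\<close> that become transversals.\<close>
  define L where "L c = {e \<in> edges H. \<forall>v\<in>e. part (c v) \<noteq> 1}" for c
  define G where "G c = {e \<in> K. \<forall>i\<in>{1..k}. \<exists>v\<in>e. part (c v) = i}" for c
  \<comment> \<open>The number of ways to extend a colouring of a fixed \<open>k\<close>-set to all
    of \<open>V\<close>; this common factor cancels at the end.\<close>
  define M where "M = N ^ (n - k)"
  have finV: "finite V" using assms(1) by (simp add: V_def kgraph_def)
  have finE: "finite (edges H)" by (rule finite_edges[OF assms(1)])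
  have subE: "edges H \<subseteq> nsets V k" using assms(1) by (simp add: kgraph_def V_def)
  have finK: "finite K" using finV by (simp add: K_def finite_imp_finite_nsets)
  have finP: "finite P" using finV by (simp add: P_def finite_PiE)
  have cardP: "card P = N ^ k * M"
    using True finV by (simp add: P_def M_def n_def V_def card_PiE flip: power_add)
  have M: "M > 0" using assms by (simp add: M_def)
  have cardK: "card K = (n choose k) - card (edges H)"
    using subE finE by (simp add: K_def n_def card_Diff_subset card_nsets)
  have kset: "e \<subseteq> V" "finite e" "card e = k" if "e \<in> nsets V k" for e
    using that by (auto simp: nsets_def)

  \<comment> \<open>The augmented graph has at least e(H) - |L c| + |G c| edges, stated without
    subtraction.\<close>
  have step: "card (edges H) + card (G c) \<le> T + card (L c)" for c
  proof -
    have "(part \<circ> c) ` verts H \<subseteq> {1..k}" using assms(2) by (auto simp: part_def)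
    from T[OF this] have T': "card (edges (augment k H (part \<circ> c))) \<le> T" .
    have "edges H \<union> G c \<subseteq> edges (augment k H (part \<circ> c)) \<union> L c"
      by (auto simp: augment_def transversals_def L_def G_def K_def V_def)
    moreover have "finite (edges (augment k H (part \<circ> c)) \<union> L c)"
      using finite_edges[OF kgraph_augment[OF assms(1)]] finE by (auto simp: L_def)
    ultimately have "card (edges H \<union> G c) \<le> card (edges (augment k H (part \<circ> c)) \<union> L c)"
      by (intro card_mono)
    moreover have "\<dots> \<le> card (edges (augment k H (part \<circ> c))) + card (L c)"
      by (rule card_Un_le)
    moreover have "card (edges H \<union> G c) = card (edges H) + card (G c)"
      using finE finK by (intro card_Un_disjoint) (auto simp: G_def K_def)
    ultimately show ?thesis using T' by linarith
  qed

  \<comment> \<open>An edge is lost only if all its \<open>k\<close> vertices receive one of the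
    \<open>k - 1\<close> colours \<open>2, ..., k\<close>.\<close>
  have lost: "card {c \<in> P. \<forall>v\<in>e. part (c v) \<noteq> 1} \<le> (k - 1) ^ k * M" if "e \<in> edges H" for e
  proof -
    note e = kset[OF subsetD[OF subE that]]
    let ?Q = "PiE V (\<lambda>v. if v \<in> e then {2..k} else {1..N})"
    have "{c \<in> P. \<forall>v\<in>e. part (c v) \<noteq> 1} \<subseteq> ?Q"
      by (auto simp: P_def PiE_iff part_def extensional_def split: if_splits)
    then have "card {c \<in> P. \<forall>v\<in>e. part (c v) \<noteq> 1} \<le> card ?Q"
      using finV by (intro card_mono finite_PiE) auto
    also have "\<dots> = (k - 1) ^ k * M"
      using e by (simp add: card_PiE_constrained[OF finV e(1)] M_def n_def)
    finally show ?thesis .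
  qed

  have gained: "(N - k + 1) * M \<le> card {c \<in> P. \<forall>i\<in>{1..k}. \<exists>v\<in>e. part (c v) = i}"
    if "e \<in> K" for e
  proof -
    have "e \<in> nsets V k" using that by (simp add: K_def)
    note e = kset[OF this]
    \<comment> \<open>One fixed assignment of the vertices of \<open>e\<close> to the parts suffices
      for the lower bound. The vertex sent to part 1 has \<open>N - k + 1\<close> admissible
      colours, every other vertex of \<open>e\<close> just one.\<close>
    obtain b where b: "bij_betw b e {1..k}"
      using finite_same_card_bij[OF e(2)] e(3) by force
    define B where "B v = (if b v = 1 then {1..N} - {2..k} else {b v})" for v
    let ?Q = "PiE V (\<lambda>v. if v \<in> e then B v else {1..N})"
    have "card ({1..N} - {2..k}) = N - k + 1"
      using assms(2,3) by (subst card_Diff_subset) auto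
    then have cB: "card (B v) = (if b v = 1 then N - k + 1 else 1)" for v
      by (simp add: B_def)
    have "(\<Prod>v\<in>e. card (B v)) = (\<Prod>i\<in>{1..k}. if i = 1 then N - k + 1 else 1)"
      unfolding cB by (rule prod.reindex_bij_betw[OF b])
    also have "\<dots> = N - k + 1"
      using assms(2) by (simp add: prod.delta)
    finally have "card ?Q = (N - k + 1) * M"
      using e by (simp add: card_PiE_constrained[OF finV e(1)] M_def n_def)
    moreover have "?Q \<subseteq> {c \<in> P. \<forall>i\<in>{1..k}. \<exists>v\<in>e. part (c v) = i}"
    proof
      fix c assume c: "c \<in> ?Q"
      have b1: "b v \<in> {1..k}" if "v \<in> e" for v
        using b that by (auto simp: bij_betw_def)
      have cv: "c v \<in> B v" if "v \<in> e" for v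
        using PiE_mem[OF c, of v] that e(1) by auto
      have pc: "part (c v) = b v" if "v \<in> e" for v
        using cv[OF that] b1[OF that] by (auto simp: B_def part_def split: if_splits)
      have "c v \<in> {1..N}" if "v \<in> V" for v
      proof (cases "v \<in> e")
        case True
        then show ?thesis
          using cv[OF True] b1[OF True] assms(3) by (auto simp: B_def split: if_splits)
      next
        case False
        then show ?thesis using PiE_mem[OF c that] by auto
      qed
      then have "c \<in> P" using c by (auto simp: P_def PiE_iff)
      moreover have "\<exists>v\<in>e. part (c v) = i" if i: "i \<in> {1..k}" for i
      proof -
        have "i \<in> b ` e" using b i by (simp add: bij_betw_def)
        then show ?thesis using pc by auto
      qed
      ultimately show "c \<in> {c \<in> P. \<forall>i\<in>{1..k}. \<exists>v\<in>e. part (c v) = i}" by blast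
    qed
    moreover have "finite {c \<in> P. \<forall>i\<in>{1..k}. \<exists>v\<in>e. part (c v) = i}"
      using finP by simp
    ultimately show ?thesis
      using card_mono[of "{c \<in> P. \<forall>i\<in>{1..k}. \<exists>v\<in>e. part (c v) = i}" ?Q] by simp
  qed

  \<comment> \<open>Double counting of pairs of a colouring and an edge, first for the losses and
    then for the gains.\<close>
  have "(\<Sum>c\<in>P. card (L c)) = (\<Sum>e\<in>edges H. card {c \<in> P. \<forall>v\<in>e. part (c v) \<noteq> 1})"
    unfolding L_def by (intro sum_multicount_gen finP finE) simp
  also have "\<dots> \<le> (\<Sum>e\<in>edges H. (k - 1) ^ k * M)"
    by (intro sum_mono lost)
  finally have SL: "(\<Sum>c\<in>P. card (L c)) \<le> card (edges H) * (k - 1) ^ k * M" by simp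
  have "(\<Sum>e\<in>K. (N - k + 1) * M) \<le> (\<Sum>e\<in>K. card {c \<in> P. \<forall>i\<in>{1..k}. \<exists>v\<in>e. part (c v) = i})"
    by (intro sum_mono gained)
  also have "\<dots> = (\<Sum>c\<in>P. card (G c))"
    unfolding G_def by (rule sum_multicount_gen[symmetric]) (use finP finK in auto)
  finally have SG: "card K * (N - k + 1) * M \<le> (\<Sum>c\<in>P. card (G c))"
    by (simp add: algebra_simps)
  have "(\<Sum>c\<in>P. card (edges H) + card (G c)) \<le> (\<Sum>c\<in>P. T + card (L c))"
    by (intro sum_mono step)
  then have "card P * card (edges H) + (\<Sum>c\<in>P. card (G c)) \<le> card P * T + (\<Sum>c\<in>P. card (L c))"
    by (simp add: sum.distrib)
  with SL SG have "card P * card (edges H) + card K * (N - k + 1) * M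
      \<le> card P * T + card (edges H) * (k - 1) ^ k * M" by linarith
  then have "M * (N ^ k * card (edges H) + card K * (N - k + 1))
      \<le> M * (N ^ k * T + card (edges H) * (k - 1) ^ k)"
    by (simp add: cardP algebra_simps)
  then show ?thesis using M by (simp add: cardK n_def V_def)
qed

section \<open>From a uniform gain for finite \<open>n\<close> to the densities\<close>

text \<open>A strict inequality for each \<open>n\<close> could vanish in the limit, so a gain
  \<open>\<delta>\<close> independent of \<open>n\<close> is extracted from the averaging
  inequality.\<close>

lemma turan_density_less:
  assumes "k > 0" "k \<le> m" "kgraph k F'" "edges F' \<noteq> {}" "edges F \<noteq> {}"
    and "card (verts F') \<le> m"
    and free: "\<And>(H :: nat hypergraph) p. kgraph k H \<Longrightarrow> \<not> contains_copy H F' \<Longrightarrow>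
      p ` verts H \<subseteq> {1..k} \<Longrightarrow> \<not> contains_copy (augment k H p) F"
  shows "turan_density k F' < turan_density k F"
proof -
  \<comment> \<open>The ratio at \<open>m\<close> is below 1 because the complete graph contains
    \<open>F'\<close>, and by monotonicity it bounds all later ratios.\<close>
  define d where "d = real (turan_number k m F') / real (m choose k)"
  \<comment> \<open>Chosen so that the gain per \<open>k\<close>-set, at least
    \<open>(1 - d) * (N - k + 1)\<close>, exceeds the loss, at most \<open>(k - 1) ^ k\<close>, by 1
    or more. After division by \<open>N ^ k\<close> this surplus is the density gain
    \<open>\<delta>\<close>; each of the parts \<open>2, ..., k\<close> has about
    \<open>n / N\<close> vertices on average.\<close>
  define N where "N = k + nat \<lceil>(real ((k - 1) ^ k) + 1) / (1 - d)\<rceil>"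
  define \<delta> where "\<delta> = 1 / real N ^ k"
  have N: "k \<le> N" by (simp add: N_def)
  then have \<delta>: "\<delta> > 0" using assms(1) by (simp add: \<delta>_def)
  have d: "d < 1"
    using turan_number_less_binomial[OF assms(3,4,6)] assms(2)
    by (simp add: d_def divide_less_eq)
  have "(real ((k - 1) ^ k) + 1) / (1 - d) \<le> real (N - k + 1)"
    using real_nat_ceiling_ge[of "(real ((k - 1) ^ k) + 1) / (1 - d)"] by (simp add: N_def)
  then have Nd: "real ((k - 1) ^ k) + 1 \<le> (1 - d) * real (N - k + 1)"
    using d by (simp add: pos_divide_le_eq mult.commute)
  have gain: "real (turan_number k n F') / real (n choose k) + \<delta>
      \<le> real (turan_number k n F) / real (n choose k)" if "n \<ge> m" for n
  proof -
    let ?C = "real (n choose k)" and ?e = "real (turan_number k n F')"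
      and ?T = "real (turan_number k n F)" and ?q = "real ((k - 1) ^ k)"
    have C: "?C > 0" using that assms(2) by simp
    have "?e / ?C \<le> d"
      unfolding d_def by (rule turan_ratio_antimono[OF assms(4,2) that])
    then have e: "?e \<le> d * ?C" using C by (simp add: field_simps)
    obtain H :: "nat hypergraph" where H: "kgraph k H" "card (verts H) = n"
      "\<not> contains_copy H F'" "card (edges H) = turan_number k n F'"
      using turan_number_attained[OF assms(4)] by blast
    have "card (edges (augment k H p)) \<le> turan_number k n F" if "p ` verts H \<subseteq> {1..k}" for p
      using card_edges_le_turan_number[OF kgraph_augment[OF H(1)] free[OF H(1,3) that]] H(2)
      by (simp add: augment_def)
    from augment_average[OF H(1) assms(1) N this]
    have nat_ineq: "N ^ k * turan_number k n F' + ((n choose k) - turan_number k n F') * (N - k + 1)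
        \<le> N ^ k * turan_number k n F + turan_number k n F' * (k - 1) ^ k"
      using H by simp
    \<comment> \<open>This makes the natural-number subtraction exact when the inequality is moved
      to the reals.\<close>
    have "turan_number k n F' \<le> n choose k" using card_edges_le[OF H(1)] H by simp
    then have avg: "real N ^ k * ?e + (?C - ?e) * real (N - k + 1) \<le> real N ^ k * ?T + ?e * ?q"
      using iffD2[OF of_nat_le_iff[where 'a = real] nat_ineq]
      by (simp only: of_nat_add of_nat_mult of_nat_power of_nat_diff)
    have "?e * ?q \<le> ?C * ?q"
      using \<open>turan_number k n F' \<le> n choose k\<close> by (intro mult_right_mono) auto
    moreover have "?C * (?q + 1) \<le> ?C * ((1 - d) * real (N - k + 1))"
      using C Nd by (intro mult_left_mono) auto
    moreover have "(1 - d) * ?C * real (N - k + 1) \<le> (?C - ?e) * real (N - k + 1)"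
      using e by (intro mult_right_mono) (auto simp: algebra_simps)
    ultimately have "real N ^ k * ?e + ?C \<le> real N ^ k * ?T"
      using avg by (simp only: distrib_left mult_1_right mult.assoc mult.left_commute mult.commute)
    moreover have "real N ^ k > 0" using N assms(1) by simp
    ultimately have "?e + \<delta> * ?C \<le> ?T"
      by (simp add: \<delta>_def field_simps)
    then have "(?e + \<delta> * ?C) / ?C \<le> ?T / ?C"
      using C by (intro divide_right_mono) auto
    then show ?thesis using C by (simp add: add_divide_distrib)
  qed
  have "(\<lambda>n. real (turan_number k n F') / real (n choose k) + \<delta>)
      \<longlonglongrightarrow> turan_density k F' + \<delta>"
    by (intro tendsto_add turan_density_LIMSEQ assms(4) tendsto_const)
  then have "turan_density k F' + \<delta> \<le> turan_density k F"
    by (rule LIMSEQ_le[OF _ turan_density_LIMSEQ[OF assms(5)]])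
      (intro exI[of _ m] allI impI gain)
  with \<delta> show ?thesis by simp
qed

text \<open>Either condition enters only through the \<open>F\<close>-freeness of the augmented
  graphs. An edge of \<open>F'\<close>, which is also an edge of \<open>F\<close>, ensures that the
  Turan numbers of both graphs are attained.\<close>

theorem theorem1p4:
  fixes F F' :: "'a hypergraph" and k m :: nat
  assumes "3 \<le> k" and "k < m"
    and "kgraph k F" and "card (verts F) = m"
    and "kgraph k F'" and "subhypergraph F' F"
    and "edges F' \<noteq> {}"
    and "turan_number k m F' + (\<Prod>i=0..k-1. (m + i) div k) < card (edges F)
      \<or> (\<forall>V :: nat \<Rightarrow> 'a set.
            disjoint_family_on V {1..k} \<and> (\<Union>i\<in>{1..k}. V i) = verts F
              \<and> (\<forall>e\<in>edges F. e \<inter> V 1 \<noteq> {})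
            \<longrightarrow> (\<exists>j\<in>{2..k}. contains_copy (delete_verts F (V j)) F'))"
  shows "turan_density k F' < turan_density k F"
proof (rule turan_density_less[where m = m])
  show "card (verts F') \<le> m"
    using assms(3,4,6) card_mono by (auto simp: kgraph_def subhypergraph_def)
  show "edges F \<noteq> {}" using assms(6,7) by (auto simp: subhypergraph_def)
  show "k > 0" "k \<le> m" using assms by auto
  fix H :: "nat hypergraph" and p :: "nat \<Rightarrow> nat"
  assume H: "kgraph k H" "\<not> contains_copy H F'" "p ` verts H \<subseteq> {1..k}"
  from assms(8) show "\<not> contains_copy (augment k H p) F"
  proof
    assume "turan_number k m F' + (\<Prod>i=0..k-1. (m + i) div k) < card (edges F)"
    then show ?thesis
      using augment_free_of_many_edges[OF \<open>k > 0\<close> assms(3,4) _ H] by blast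
  next
    assume *: "\<forall>V :: nat \<Rightarrow> 'a set.
            disjoint_family_on V {1..k} \<and> (\<Union>i\<in>{1..k}. V i) = verts F
              \<and> (\<forall>e\<in>edges F. e \<inter> V 1 \<noteq> {})
            \<longrightarrow> (\<exists>j\<in>{2..k}. contains_copy (delete_verts F (V j)) F')"
    show ?thesis
      by (rule augment_free_of_partition[OF assms(3) _ \<open>k > 0\<close> H(2,3)]) (use * in blast)
  qed
qed (rule assms(5) assms(7))+

end
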